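(* The number of consecutive equi-$n$-squares (the number of elements of $\Sigma_n$) is $$\left(\sum_{i=1}^{n}(-2)^{i+1}\binom{n}{i}\frac{(n^2-in)!}{((n-i)!)^{n}}\right)-\frac{4n\,(n^2-2n+1)!}{(n-1)!\,((n-2)!)^{n-1}}+\frac{8\lfloor n/2\rfloor\,(n^2-3n+2)!}{((n-2)!)^2\,((n-3)!)^{n-2}}-\frac{2\lfloor n/2\rfloor\,(n^2-4n+4)!}{((n-2)!)^2\,((n-4)!)^{n-2}},$$ and $$|\Sigma_n|\sim\frac{4n\,(n^2-n)!}{((n-1)!)^{n}}.$$
   Context: An equi-$n$-square is an $n\times n$ array with entries in $\{1,\dots,n\}$ in which each symbol $1,\dots,n$ occurs exactly $n$ times in the whole array. A row (read left to right) or column (read top to bottom) is called consecutive if it equals $(1,2,\dots,n)$ or $(n,n-1,\dots,1)$. An equi-$n$-square is called consecutive if at least one of its rows or columns is consecutive; $\Sigma_n$ is the set of all consecutive equi-$n$-squares. The symbol $\sim$ denotes asymptotic equivalence as $n\to\infty$ (the ratio of the two sides tends to $1$).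
   Formalization: The exact formula is stated for n ≥ 2 only: at n = 1 it involves factorials of negative numbers and, read naturally, gives 0 while |Σ_1| = 1; for n = 2, 3 a factor 1/m! with m < 0 is read as 0 and (m!)^0 as 1. *)

theory Defs
  imports Complex_Main "HOL-Library.FuncSet" "HOL-Library.Landau_Symbols"
begin

text \<open>
  An \<open>n \<times> n\<close> array is an extensional function on index pairs (row, column), both counted from 1,
  so that arrays form a finite set and two arrays are equal iff all their entries agree.
\<close>

definition equi_squares :: "nat \<Rightarrow> (nat \<times> nat \<Rightarrow> nat) set" where
  "equi_squares n =
     {A \<in> ({1..n} \<times> {1..n}) \<rightarrow>\<^sub>E {1..n}.
        \<forall>k\<in>{1..n}. card {p \<in> {1..n} \<times> {1..n}. A p = k} = n}"

definition array_row :: "nat \<Rightarrow> (nat \<times> nat \<Rightarrow> nat) \<Rightarrow> nat \<Rightarrow> nat list" where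
  "array_row n A i = map (\<lambda>j. A (i, j)) [1..<n + 1]"

definition array_column :: "nat \<Rightarrow> (nat \<times> nat \<Rightarrow> nat) \<Rightarrow> nat \<Rightarrow> nat list" where
  "array_column n A j = map (\<lambda>i. A (i, j)) [1..<n + 1]"

definition consecutive_line :: "nat \<Rightarrow> nat list \<Rightarrow> bool" where
  "consecutive_line n xs \<longleftrightarrow> xs = [1..<n + 1] \<or> xs = rev [1..<n + 1]"

definition consecutive_equi_squares :: "nat \<Rightarrow> (nat \<times> nat \<Rightarrow> nat) set" where
  "consecutive_equi_squares n =
     {A \<in> equi_squares n.
        (\<exists>i\<in>{1..n}. consecutive_line n (array_row n A i)) \<or>
        (\<exists>j\<in>{1..n}. consecutive_line n (array_column n A j))}"

text \<open>
  The factorial of an integer. The closed formula for the number of consecutive equi-\<open>n\<close>-squares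
  has \<open>(n - 3)!\<close> and \<open>(n - 4)!\<close> in denominators, where \<open>n - 3 < 0\<close> for \<open>n = 2\<close> and \<open>n - 4 < 0\<close> for
  \<open>n \<in> {2, 3}\<close>. As usual, \<open>1 / m!\<close> is read as
  \<open>0\<close> for \<open>m < 0\<close> (compare \<open>1 / \<Gamma>(m + 1)\<close>); since \<open>x / 0 = 0\<close> in HOL, the value \<open>0\<close> for \<open>m!\<close> has
  this effect. A factor \<open>(m!)\<^sup>0\<close> is \<open>1\<close>. Truncated subtraction on \<open>nat\<close> would
  instead give a wrong last term for \<open>n = 3\<close>. For \<open>n \<ge> 4\<close> no negative argument occurs.
\<close>

definition int_fact :: "int \<Rightarrow> real" where
  "int_fact m = (if m < 0 then 0 else fact (nat m))"

end

theory Submission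
  imports Defs "HOL-Real_Asymp.Real_Asymp"
begin

text \<open>
  Let \<open>R\<close> and \<open>C\<close> be the sets of equi-squares with a consecutive row and column, respectively.
  Transposition gives \<open>|R| = |C|\<close>, so the number sought is \<open>2 |R| - |R \<inter> C|\<close>, and inclusion-exclusion
  is applied to \<open>R\<close> and to \<open>R \<inter> C\<close> separately. Prescribing \<open>i\<close> rows leaves a multinomial coefficient,
  which gives the sum over \<open>i\<close>. For \<open>R \<inter> C\<close>, encode a line as a pair \<open>(i, d)\<close> of index and direction:
  a row line and a column line are compatible iff they belong to the same orbit
  \<open>{(r, False), (n + 1 - r, True)}\<close>. Hence only the pairs of nonempty subsets of one orbit contribute:
  four crossings for every \<open>r\<close>, and, unless \<open>r = n + 1 - r\<close> (when both lines of the orbit occupy the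
  same row), four configurations of three lines and one of four lines.

  For the asymptotics, Bonferroni's inequality leaves the single-line term \<open>4 n N\<^sub>1\<close>; prescribing a
  second line divides the count by at least \<open>(n - 1)\<^sup>n\<^sup>-\<^sup>1\<close>, so the \<open>O(n\<^sup>2)\<close> pairs are negligible.
\<close>

section \<open>Inclusion-exclusion and Bonferroni\<close>

text \<open>Inclusion-exclusion for the events \<open>l \<in> T A\<close>: their union is
  \<open>T A \<noteq> {}\<close>, and the intersection over \<open>B\<close> is
  \<open>B \<subseteq> T A\<close>. \<open>Incl_Excl_UN\<close> applies because the function taking
  \<open>S\<close> to \<open>card (E \<inter> S)\<close> is additive.\<close>

lemma sum_nonempty_subsets:
  fixes f :: "'l set \<Rightarrow> 'a set \<Rightarrow> real"
  assumes "finite L" "finite E" "\<And>A. A \<in> E \<Longrightarrow> T A \<subseteq> L"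
  shows "real (card {A \<in> E. T A \<noteq> {}}) =
    (\<Sum>B | B \<subseteq> L \<and> B \<noteq> {}. (-1) ^ (card B + 1) * real (card {A \<in> E. B \<subseteq> T A}))"
proof -
  have add: "real (card (E \<inter> (S \<union> S'))) = real (card (E \<inter> S)) + real (card (E \<inter> S'))"
    if "disjnt S S'" for S S'
    using that assms(2) by (subst Int_Un_distrib, subst card_Un_disjoint) (auto simp: disjnt_def)
  have "{A \<in> E. T A \<noteq> {}} = E \<inter> (\<Union>l\<in>L. {A. l \<in> T A})"
    using assms(3) by auto
  moreover have "{A \<in> E. B \<subseteq> T A} = E \<inter> (\<Inter>l\<in>B. {A. l \<in> T A})" for B
    by auto
  ultimately show ?thesis
    using Incl_Excl_UN[of "\<lambda>S. real (card (E \<inter> S))" L "\<lambda>l. {A. l \<in> T A}"] add assms(1) by simp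
qed

text \<open>For a single \<open>A\<close> with \<open>t = card (T A)\<close> the claim is
  \<open>t - t (t - 1) \<le> of_bool (t > 0)\<close>; this is summed over \<open>E\<close>. The
  pairs are ordered, so twice the usual pair term is subtracted, which is harmless for the
  asymptotics.\<close>

lemma card_bonferroni_lower:
  assumes "finite L" "finite E" "\<And>A. A \<in> E \<Longrightarrow> T A \<subseteq> L"
  shows "(\<Sum>l\<in>L. real (card {A \<in> E. l \<in> T A}))
      - (\<Sum>l\<in>L. \<Sum>m\<in>L - {l}. real (card {A \<in> E. l \<in> T A \<and> m \<in> T A}))
    \<le> real (card {A \<in> E. T A \<noteq> {}})"
proof -
  have card_eq: "real (card {A \<in> E. P A}) = (\<Sum>A\<in>E. of_bool (P A))" for P
    using assms(2) by (simp add: Int_def)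
  have "(\<Sum>l\<in>L. real (card {A \<in> E. l \<in> T A}))
      - (\<Sum>l\<in>L. \<Sum>m\<in>L - {l}. real (card {A \<in> E. l \<in> T A \<and> m \<in> T A}))
    = (\<Sum>A\<in>E. (\<Sum>l\<in>L. of_bool (l \<in> T A))
        - (\<Sum>l\<in>L. \<Sum>m\<in>L-{l}. of_bool (l \<in> T A \<and> m \<in> T A)))"
    unfolding card_eq sum_subtractf by (simp only: sum.swap[of _ E])
  also have "\<dots> \<le> (\<Sum>A\<in>E. of_bool (T A \<noteq> {}))"
  proof (rule sum_mono)
    fix A assume "A \<in> E"
    with assms have sub: "T A \<subseteq> L" by simp
    have fin: "finite (T A)" using sub assms(1) finite_subset by auto
    have 1: "(\<Sum>l\<in>L. of_bool (l \<in> T A)) = real (card (T A))"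
      using sub assms(1) by (simp add: Int_def) (metis Collect_mem_eq Int_def inf.absorb2)
    have "(\<Sum>m\<in>L-{l}. of_bool (l \<in> T A \<and> m \<in> T A)) = of_bool (l \<in> T A) * (real (card (T A)) - 1)" 
      if "l \<in> L" for l
    proof (cases "l \<in> T A")
      case True
      have "(L - {l}) \<inter> {m. m \<in> T A} = T A - {l}" using sub by auto
      moreover have "card (T A) \<ge> 1" using True fin by (metis One_nat_def Suc_leI card_gt_0_iff empty_iff)
      ultimately show ?thesis using True assms(1) fin by (simp add: of_nat_diff)
    qed simp
    then have "(\<Sum>l\<in>L. \<Sum>m\<in>L-{l}. of_bool (l \<in> T A \<and> m \<in> T A))
        = real (card (T A)) * (real (card (T A)) - 1)"
      using 1 by (simp flip: sum_distrib_right)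
    moreover have "real (card (T A)) - real (card (T A)) * (real (card (T A)) - 1) \<le> of_bool (T A \<noteq> {})"
    proof (cases "T A = {}")
      case False
      \<comment> \<open>Expanding this square gives
        \<open>t - t (t - 1) = 2 t - t\<^sup>2 \<le> 1\<close> for
        \<open>t = card (T A)\<close>.\<close>
      have "0 \<le> (real (card (T A)) - 1)\<^sup>2" by simp
      then show ?thesis using False by (simp add: power2_eq_square algebra_simps)
    qed simp
    ultimately show "(\<Sum>l\<in>L. of_bool (l \<in> T A))
        - (\<Sum>l\<in>L. \<Sum>m\<in>L-{l}. of_bool (l \<in> T A \<and> m \<in> T A)) \<le> (of_bool (T A \<noteq> {}) :: real)"
      using 1 by simp
  qed
  finally show ?thesis unfolding card_eq .
qed

section \<open>Functions with prescribed fibres\<close>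

text \<open>The multinomial coefficient, in multiplicative form to avoid division on
  \<open>nat\<close>. In the induction on \<open>X\<close>, sending the new point \<open>a\<close>
  to \<open>k\<close> lowers \<open>c k\<close> by one, and this case contributes
  \<open>c k * fact (card X)\<close>.\<close>

lemma card_prescribed_fibres_mult:
  assumes "finite X" "finite K" "(\<Sum>k\<in>K. c k) = card X"
  shows "card {f \<in> X \<rightarrow>\<^sub>E K. \<forall>k\<in>K. card {x \<in> X. f x = k} = c k} * (\<Prod>k\<in>K. fact (c k)) = fact (card X)"
  using assms(1,3)
proof (induction X arbitrary: c rule: finite_induct)
  case empty
  then have "\<forall>k\<in>K. c k = 0" using assms(2) by simp
  then have "{f \<in> {} \<rightarrow>\<^sub>E K. \<forall>k\<in>K. card {x \<in> {}. f x = k} = c k} = {\<lambda>_. undefined}" by auto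
  with \<open>\<forall>k\<in>K. c k = 0\<close> show ?case by simp
next
  case (insert a X)
  define F where "F = (\<lambda>(Y :: 'a set) c. {f \<in> Y \<rightarrow>\<^sub>E K. \<forall>k\<in>K. card {x \<in> Y. f x = k} = c k})"
  define c' where "c' = (\<lambda>k. c(k := c k - 1))"
  have finF: "finite (F X d)" for d unfolding F_def
    using insert.hyps assms(2) by (auto intro: finite_subset[OF _ finite_PiE[of X "\<lambda>_. K"]])
  have cnt: "card {x \<in> insert a X. (g(a := k)) x = j} = card {x \<in> X. g x = j} + of_bool (j = k)" for g k j
  proof (cases "j = k")
    case True
    have "{x \<in> insert a X. (g(a := k)) x = j} = insert a {x \<in> X. g x = j}" using True insert.hyps by auto
    then show ?thesis using True insert.hyps by simp
  next
    case False
    have "{x \<in> insert a X. (g(a := k)) x = j} = {x \<in> X. g x = j}" using False insert.hyps by auto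
    then show ?thesis using False by simp
  qed
  \<comment> \<open>Split by the value at \<open>a\<close>. Values with \<open>c k = 0\<close> are
    left out because truncated subtraction would make \<open>c' k\<close> equal to \<open>c\<close>
    there.\<close>
  have F_eq: "F (insert a X) c = (\<Union>k\<in>{k\<in>K. c k > 0}. (\<lambda>g. g(a := k)) ` F X (c' k))"
  proof (intro set_eqI iffI)
    fix f assume f: "f \<in> F (insert a X) c"
    define k where "k = f a"
    define g where "g = f(a := undefined)"
    have fg: "f = g(a := k)" by (simp add: g_def k_def)
    have k: "k \<in> K" using f by (auto simp: F_def k_def)
    have g: "g \<in> X \<rightarrow>\<^sub>E K" using f insert.hyps by (auto simp: F_def g_def PiE_iff extensional_def)
    have *: "card {x \<in> X. g x = j} + of_bool (j = k) = c j" if "j \<in> K" for j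
      using f that cnt[of g k j] unfolding F_def fg by simp
    have "c k > 0" using *[OF k] by simp
    moreover have "g \<in> F X (c' k)" using g * by (fastforce simp: F_def c'_def)
    ultimately show "f \<in> (\<Union>k\<in>{k\<in>K. c k > 0}. (\<lambda>g. g(a := k)) ` F X (c' k))" using k fg by auto
  next
    fix f assume "f \<in> (\<Union>k\<in>{k\<in>K. c k > 0}. (\<lambda>g. g(a := k)) ` F X (c' k))"
    then obtain k g where k: "k \<in> K" "c k > 0" and g: "g \<in> F X (c' k)" and f: "f = g(a := k)" by auto
    have "f \<in> insert a X \<rightarrow>\<^sub>E K" using g k unfolding f F_def by (auto simp: PiE_iff extensional_def)
    then show "f \<in> F (insert a X) c" using g k unfolding f F_def mem_Collect_eq cnt by (auto simp: c'_def)
  qed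
  have inj: "inj_on (\<lambda>g. g(a := k)) (F X d)" for k d
  proof (rule inj_onI)
    fix g h assume gh: "g \<in> F X d" "h \<in> F X d" "g(a := k) = h(a := k)"
    have "g a = undefined" "h a = undefined" using gh insert.hyps by (auto simp: F_def PiE_iff extensional_def)
    then show "g = h" using gh(3) by (metis fun_upd_triv fun_upd_upd)
  qed
  have "card (F (insert a X) c) = (\<Sum>k\<in>{k\<in>K. c k > 0}. card (F X (c' k)))"
    unfolding F_eq
  proof (subst card_UN_disjoint)
    show "\<forall>i\<in>{k \<in> K. 0 < c k}. \<forall>j\<in>{k \<in> K. 0 < c k}. i \<noteq> j \<longrightarrow>
       (\<lambda>g. g(a := i)) ` F X (c' i) \<inter> (\<lambda>g. g(a := j)) ` F X (c' j) = {}"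
      by (auto dest: fun_upd_eqD)
  qed (use assms(2) finF in \<open>auto simp: card_image[OF inj]\<close>)
  moreover have "card (F X (c' k)) * (\<Prod>k\<in>K. fact (c k)) = c k * fact (card X)"
    if k: "k \<in> K" "c k > 0" for k
  proof -
    have rest: "(\<Sum>j\<in>K - {k}. c' k j) = (\<Sum>j\<in>K - {k}. c j)"
         "(\<Prod>j\<in>K - {k}. fact (c' k j)) = (\<Prod>j\<in>K - {k}. fact (c j) :: nat)"
      by (auto simp: c'_def intro: sum.cong prod.cong)
    have "(\<Sum>j\<in>K. c' k j) = card X"
      using insert.prems insert.hyps k assms(2) rest
      by (simp add: sum.remove[of K k]) (simp add: c'_def)
    then have IH: "card (F X (c' k)) * (\<Prod>j\<in>K. fact (c' k j)) = fact (card X)"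
      using insert.IH unfolding F_def by blast
    have "(\<Prod>j\<in>K. fact (c j)) = c k * (\<Prod>j\<in>K. fact (c' k j) :: nat)"
      using k assms(2) rest by (simp add: prod.remove[of K k] fact_reduce) (simp add: c'_def)
    then show ?thesis using IH by (simp add: mult.left_commute)
  qed
  ultimately have "card (F (insert a X) c) * (\<Prod>k\<in>K. fact (c k)) = (\<Sum>k\<in>{k\<in>K. c k > 0}. c k * fact (card X))"
    by (simp add: sum_distrib_right)
  also have "\<dots> = (\<Sum>k\<in>K. c k) * fact (card X)"
    using assms(2) by (subst sum_distrib_right, intro sum.mono_neutral_left) auto
  \<comment> \<open>The sizes \<open>c k\<close> add up to \<open>card X + 1\<close>, the missing
    factor of the factorial.\<close>
  also have "\<dots> = fact (card (insert a X))"
    using insert by simp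
  finally show ?case unfolding F_def .
qed

text \<open>The formula also covers overfull fibres of \<^term>\<open>P\<close>: then some argument of \<^const>\<open>int_fact\<close> in the
  denominator is negative, and \<open>x / 0 = 0\<close> gives the correct count \<open>0\<close>.\<close>
lemma card_extensions:
  fixes P :: "'a \<Rightarrow> 'k" and m :: "'k \<Rightarrow> nat"
  assumes "finite X" "finite K" "D \<subseteq> X" "\<And>x. x \<in> D \<Longrightarrow> P x \<in> K" "(\<Sum>k\<in>K. m k) = card X"
  shows "real (card {f \<in> X \<rightarrow>\<^sub>E K. (\<forall>k\<in>K. card {x \<in> X. f x = k} = m k) \<and> (\<forall>x\<in>D. f x = P x)})
    = int_fact (int (card X) - int (card D)) /
      (\<Prod>k\<in>K. int_fact (int (m k) - int (card {x \<in> D. P x = k})))"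
    (is "real (card ?S) = _")
proof -
  have finD: "finite D" using assms finite_subset by auto
  define c where "c = (\<lambda>k. card {x \<in> D. P x = k})"
  have split: "card {x \<in> X. f x = k} = c k + card {x \<in> X - D. f x = k}" if "\<forall>x\<in>D. f x = P x" for f k
  proof -
    have "{x \<in> X. f x = k} = {x \<in> D. P x = k} \<union> {x \<in> X - D. f x = k}" using that assms(3) by auto
    moreover have "{x \<in> D. P x = k} \<inter> {x \<in> X - D. f x = k} = {}" by auto
    ultimately show ?thesis using finD assms(1) by (simp add: c_def card_Un_disjoint)
  qed
  show ?thesis
  proof (cases "\<forall>k\<in>K. c k \<le> m k")
    case False
    then obtain k where k: "k \<in> K" "m k < c k" by auto
    then have "?S = {}" using split by fastforce
    moreover have "(\<Prod>k\<in>K. int_fact (int (m k) - int (c k))) = 0"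
      using k assms(2) by (subst prod_zero_iff) (auto simp: int_fact_def intro!: bexI[of _ k])
    ultimately show ?thesis by (simp only: c_def card.empty of_nat_0 div_by_0)
  next
    case True
    define R where "R = {f \<in> X - D \<rightarrow>\<^sub>E K. \<forall>k\<in>K. card {x \<in> X - D. f x = k} = m k - c k}"
    \<comment> \<open>Forgetting the prescribed points is inverted by filling them in from
      \<open>P\<close>; on \<open>X - D\<close> the fibre sizes that remain are
      \<open>m k - c k\<close>.\<close>
    have bij: "bij_betw (\<lambda>f. restrict f (X - D)) ?S R"
    proof (rule bij_betwI[where g = "\<lambda>g x. if x \<in> D then P x else g x"])
      show "(\<lambda>f. restrict f (X - D)) \<in> ?S \<rightarrow> R"
      proof
        fix f assume f: "f \<in> ?S"
        have "{x \<in> X - D. restrict f (X - D) x = k} = {x \<in> X - D. f x = k}" for k by auto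
        then show "restrict f (X - D) \<in> R" using f split[of f] by (auto simp: R_def)
      qed
      show "(\<lambda>g x. if x \<in> D then P x else g x) \<in> R \<rightarrow> ?S"
      proof
        fix g assume g: "g \<in> R"
        let ?f = "\<lambda>x. if x \<in> D then P x else g x"
        have "{x \<in> X - D. ?f x = k} = {x \<in> X - D. g x = k}" for k by auto
        then have "card {x \<in> X. ?f x = k} = m k" if "k \<in> K" for k
          using g split[of ?f k] True that by (auto simp: R_def)
        moreover have "?f \<in> X \<rightarrow>\<^sub>E K" using g assms(3,4) by (auto simp: R_def PiE_iff extensional_def)
        ultimately show "?f \<in> ?S" by simp
      qed
      show "(\<lambda>x. if x \<in> D then P x else restrict f (X - D) x) = f" if "f \<in> ?S" for f
        using that by (auto simp: fun_eq_iff PiE_iff extensional_def)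
      show "restrict (\<lambda>x. if x \<in> D then P x else g x) (X - D) = g" if "g \<in> R" for g
        using that by (auto simp: fun_eq_iff PiE_iff extensional_def R_def)
    qed
    have sumc: "(\<Sum>k\<in>K. c k) = card D"
    proof -
      have "card D = card (\<Union>k\<in>K. {x \<in> D. P x = k})"
        using assms(4) by (intro arg_cong[of _ _ card]) auto
      also have "\<dots> = (\<Sum>k\<in>K. c k)"
        unfolding c_def using finD assms(2) by (intro card_UN_disjoint) auto
      finally show ?thesis by simp
    qed
    have cardXD: "card (X - D) = card X - card D" "card D \<le> card X"
      using assms(1,3) finD by (auto simp: card_Diff_subset card_mono)
    have "(\<Sum>k\<in>K. m k - c k) = card (X - D)"
      using True assms(5) sumc cardXD by (simp add: sum_subtractf_nat)
    then have "card R * (\<Prod>k\<in>K. fact (m k - c k)) = fact (card (X - D))"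
      unfolding R_def using assms(1,2) by (intro card_prescribed_fibres_mult) auto
    then have "real (card R * (\<Prod>k\<in>K. fact (m k - c k))) = real (fact (card (X - D)))"
      by (rule arg_cong)
    then have "real (card R) * (\<Prod>k\<in>K. fact (m k - c k)) = fact (card (X - D))"
      by (simp only: of_nat_mult of_nat_prod of_nat_fact)
    moreover have "(\<Prod>k\<in>K. fact (m k - c k) :: real) \<noteq> 0" using assms(2) by simp
    ultimately have "real (card R) = fact (card (X - D)) / (\<Prod>k\<in>K. fact (m k - c k))"
      by (simp add: field_simps)
    moreover have "int_fact (int (m k) - int (c k)) = fact (m k - c k)" if "k \<in> K" for k
      using True that by (simp add: int_fact_def flip: of_nat_diff)
    moreover have "int_fact (int (card X) - int (card D)) = fact (card (X - D))"
      using cardXD by (simp add: int_fact_def flip: of_nat_diff)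
    ultimately show ?thesis using bij_betw_same_card[OF bij] by (simp add: c_def)
  qed
qed

section \<open>Squares with prescribed lines\<close>

definition line_entry :: "nat \<Rightarrow> bool \<Rightarrow> nat \<Rightarrow> nat" where
  "line_entry n d j = (if d then n + 1 - j else j)"

definition row_lines :: "nat \<Rightarrow> (nat \<times> nat \<Rightarrow> nat) \<Rightarrow> (nat \<times> bool) set" where
  "row_lines n A = {(i, d). i \<in> {1..n} \<and> (\<forall>j\<in>{1..n}. A (i, j) = line_entry n d j)}"

definition col_lines :: "nat \<Rightarrow> (nat \<times> nat \<Rightarrow> nat) \<Rightarrow> (nat \<times> bool) set" where
  "col_lines n A = {(j, d). j \<in> {1..n} \<and> (\<forall>i\<in>{1..n}. A (i, j) = line_entry n d i)}"

definition line_count :: "nat \<Rightarrow> (nat \<times> bool) set \<Rightarrow> (nat \<times> bool) set \<Rightarrow> nat" where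
  "line_count n S T = card {A \<in> equi_squares n. S \<subseteq> row_lines n A \<and> T \<subseteq> col_lines n A}"

lemma row_lines_subset: "row_lines n A \<subseteq> {1..n} \<times> UNIV"
  and col_lines_subset: "col_lines n A \<subseteq> {1..n} \<times> UNIV"
  by (auto simp: row_lines_def col_lines_def)

lemma finite_equi_squares: "finite (equi_squares n)"
  unfolding equi_squares_def
  by (rule finite_subset[OF _ finite_PiE[of "{1..n} \<times> {1..n}" "\<lambda>_. {1..n}"]]) auto

lemma consecutive_line_iff:
  "consecutive_line n (map h [1..<n + 1]) \<longleftrightarrow> (\<exists>d. \<forall>j\<in>{1..n}. h j = line_entry n d j)"
proof -
  have "map h [1..<n + 1] = [1..<n + 1] \<longleftrightarrow> (\<forall>j\<in>{1..n}. h j = j)"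
    by (subst map_eq_conv[of h _ "\<lambda>x. x", simplified]) auto
  moreover have "rev [1..<n + 1] = map (\<lambda>j. n + 1 - j) [1..<n + 1]"
    by (rule nth_equalityI) (auto simp: rev_nth simp del: upt_Suc)
  then have "map h [1..<n + 1] = rev [1..<n + 1] \<longleftrightarrow> (\<forall>j\<in>{1..n}. h j = n + 1 - j)"
    by auto
  ultimately show ?thesis
    unfolding consecutive_line_def line_entry_def ex_bool_eq by auto
qed

lemma consecutive_equi_squares_eq:
  "consecutive_equi_squares n = {A \<in> equi_squares n. row_lines n A \<noteq> {} \<or> col_lines n A \<noteq> {}}"
  unfolding consecutive_equi_squares_def array_row_def array_column_def consecutive_line_iff
    row_lines_def col_lines_def Bex_def
  by (simp add: set_eq_iff) metis

lemma card_line_entry_eq: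
  assumes "k \<in> {1..n}"
  shows "card {j \<in> {1..n}. line_entry n d j = k} = 1"
proof -
  \<comment> \<open>\<open>line_entry n d\<close> is an involution on \<open>{1..n}\<close>, so the
    preimage of \<open>k\<close> is its image.\<close>
  have "{j \<in> {1..n}. line_entry n d j = k} = {line_entry n d k}"
    using assms by (auto simp: line_entry_def)
  then show ?thesis by simp
qed

text \<open>\<open>P\<close> is a common pattern of all prescribed lines, so its existence expresses
  their compatibility. With \<open>s\<close> row indices and \<open>t\<close> column indices the
  lines cover \<open>n (s + t) - s t\<close> cells. Every line contains every symbol once, so a
  symbol is already used \<open>s + t\<close> times, less one for each crossing that carries it. The
  rest is \<open>card_extensions\<close>.\<close>

lemma line_count_eq:
  assumes S: "S \<subseteq> {1..n} \<times> UNIV" "\<And>i d j. (i, d) \<in> S \<Longrightarrow> j \<in> {1..n} \<Longrightarrow> P (i, j) = line_entry n d j"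
    and T: "T \<subseteq> {1..n} \<times> UNIV" "\<And>j d i. (j, d) \<in> T \<Longrightarrow> i \<in> {1..n} \<Longrightarrow> P (i, j) = line_entry n d i"
  shows "real (line_count n S T) =
    int_fact (int n ^ 2 - int n * (int (card (fst ` S)) + int (card (fst ` T)))
        + int (card (fst ` S)) * int (card (fst ` T)))
    / (\<Prod>k\<in>{1..n}. int_fact (int n - int (card (fst ` S)) - int (card (fst ` T))
        + (\<Sum>a\<in>fst ` S. \<Sum>b\<in>fst ` T. of_bool (P (a, b) = k))))"
proof -
  define I J K where "I = fst ` S" and "J = fst ` T" and "K = {1..n}"
  define D where "D = I \<times> K \<union> K \<times> J"
  have IJ: "I \<subseteq> K" "J \<subseteq> K" using S T by (auto simp: I_def J_def K_def)
  have fin: "finite I" "finite J" "finite K" using IJ finite_subset by (auto simp: K_def)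
  have I: "\<exists>d. \<forall>j\<in>K. P (i, j) = line_entry n d j" if "i \<in> I" for i
    using that S(2) by (force simp: I_def K_def)
  have J: "\<exists>d. \<forall>i\<in>K. P (i, j) = line_entry n d i" if "j \<in> J" for j
    using that T(2) by (force simp: J_def K_def)
  have range: "P q \<in> K" if q: "q \<in> D" for q
  proof -
    have entry: "line_entry n d j \<in> K" if "j \<in> K" for d j using that by (auto simp: K_def line_entry_def)
    obtain a b where ab: "q = (a, b)" "a \<in> I \<and> b \<in> K \<or> a \<in> K \<and> b \<in> J" using q by (auto simp: D_def)
    then show ?thesis using I[of a] J[of b] entry by metis
  qed
  have set_eq: "{A \<in> equi_squares n. S \<subseteq> row_lines n A \<and> T \<subseteq> col_lines n A} =
     {A \<in> K \<times> K \<rightarrow>\<^sub>E K. (\<forall>k\<in>K. card {p \<in> K \<times> K. A p = k} = n) \<and> (\<forall>q\<in>D. A q = P q)}"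
  proof -
    have "S \<subseteq> row_lines n A \<and> T \<subseteq> col_lines n A \<longleftrightarrow> (\<forall>q\<in>D. A q = P q)" for A
    proof
      assume "S \<subseteq> row_lines n A \<and> T \<subseteq> col_lines n A"
      then show "\<forall>q\<in>D. A q = P q"
        using S(2) T(2) by (fastforce simp: D_def I_def J_def K_def row_lines_def col_lines_def)
    next
      assume A: "\<forall>q\<in>D. A q = P q"
      have "(i, d) \<in> row_lines n A" if "(i, d) \<in> S" for i d
      proof -
        have "i \<in> I" using that by (force simp: I_def)
        then have "A (i, j) = line_entry n d j" if "j \<in> K" for j
          using that A S(2)[OF \<open>(i, d) \<in> S\<close>] by (simp add: D_def K_def)
        then show ?thesis using \<open>i \<in> I\<close> IJ by (auto simp: row_lines_def K_def)
      qed
      moreover have "(j, d) \<in> col_lines n A" if "(j, d) \<in> T" for j d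
      proof -
        have "j \<in> J" using that by (force simp: J_def)
        then have "A (i, j) = line_entry n d i" if "i \<in> K" for i
          using that A T(2)[OF \<open>(j, d) \<in> T\<close>] by (simp add: D_def K_def)
        then show ?thesis using \<open>j \<in> J\<close> IJ by (auto simp: col_lines_def K_def)
      qed
      ultimately show "S \<subseteq> row_lines n A \<and> T \<subseteq> col_lines n A" by auto
    qed
    then show ?thesis unfolding equi_squares_def K_def by blast
  qed
  have count: "real (line_count n S T) = int_fact (int (card (K \<times> K)) - int (card D)) /
      (\<Prod>k\<in>K. int_fact (int n - int (card {q \<in> D. P q = k})))"
    unfolding line_count_def set_eq using fin IJ range
    by (intro card_extensions[where m = "\<lambda>_. n"]) (auto simp: D_def, auto simp: K_def)
  have inter: "(I \<times> K) \<inter> (K \<times> J) = I \<times> J" using IJ by auto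
  have cardD: "int (card D) = int n * (int (card I) + int (card J)) - int (card I) * int (card J)"
  proof -
    have "card D + card (I \<times> J) = card (I \<times> K) + card (K \<times> J)"
      unfolding D_def inter[symmetric] using fin by (intro card_Un_Int[symmetric]) auto
    then have "int (card D) + int (card I) * int (card J) = int (card I) * int n + int n * int (card J)"
      by (simp add: card_cartesian_product K_def flip: of_nat_mult of_nat_add)
    then show ?thesis by (simp add: algebra_simps)
  qed
  have fibre: "int (card {q \<in> D. P q = k}) = int (card I) + int (card J)
      - (\<Sum>a\<in>I. \<Sum>b\<in>J. of_bool (P (a, b) = k))" if k: "k \<in> K" for k
  proof -
    let ?U = "{q \<in> I \<times> K. P q = k}" and ?V = "{q \<in> K \<times> J. P q = k}"
    have "card {q \<in> D. P q = k} + card (?U \<inter> ?V) = card ?U + card ?V"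
      using fin by (subst card_Un_Int) (auto simp: D_def intro!: arg_cong[of _ _ card])
    moreover have "?U \<inter> ?V = {q \<in> I \<times> J. P q = k}" using inter by auto
    moreover have "int (card {q \<in> I \<times> J. P q = k}) = (\<Sum>a\<in>I. \<Sum>b\<in>J. of_bool (P (a, b) = k))"
    proof -
      have "int (card {q \<in> I \<times> J. P q = k}) = (\<Sum>q\<in>I \<times> J. of_bool (P q = k))"
        using fin by (simp add: Int_def)
      then show ?thesis by (simp add: sum.cartesian_product case_prod_beta')
    qed
    moreover have "card ?U = card I"
    proof -
      have "?U = (SIGMA i:I. {j \<in> K. P (i, j) = k})" by auto
      moreover have "card {j \<in> K. P (i, j) = k} = 1" if i: "i \<in> I" for i
      proof -
        obtain d where "\<forall>j\<in>K. P (i, j) = line_entry n d j" using I[OF i] by blast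
        then have "{j \<in> K. P (i, j) = k} = {j \<in> K. line_entry n d j = k}" by auto
        then show ?thesis using card_line_entry_eq[of k n d] k by (simp add: K_def)
      qed
      ultimately show ?thesis using fin by (simp add: card_SigmaI)
    qed
    moreover have "card ?V = card J"
    proof -
      \<comment> \<open>Listing the column index first turns the set into a dependent product, as
        \<open>card_SigmaI\<close> requires.\<close>
      have "?V = (\<lambda>(j, i). (i, j)) ` (SIGMA j:J. {i \<in> K. P (i, j) = k})" by auto
      then have "card ?V = card (SIGMA j:J. {i \<in> K. P (i, j) = k})"
        by (simp add: card_image inj_on_def case_prod_beta' prod_eq_iff)
      moreover have "card {i \<in> K. P (i, j) = k} = 1" if j: "j \<in> J" for j
      proof -
        obtain d where "\<forall>i\<in>K. P (i, j) = line_entry n d i" using J[OF j] by blast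
        then have "{i \<in> K. P (i, j) = k} = {i \<in> K. line_entry n d i = k}" by auto
        then show ?thesis using card_line_entry_eq[of k n d] k by (simp add: K_def)
      qed
      ultimately show ?thesis using fin by (simp add: card_SigmaI)
    qed
    ultimately show ?thesis by simp
  qed
  have "int (card (K \<times> K)) - int (card D)
      = int n ^ 2 - int n * (int (card I) + int (card J)) + int (card I) * int (card J)"
    unfolding cardD by (simp add: card_cartesian_product K_def power2_eq_square)
  moreover have "(\<Prod>k\<in>K. int_fact (int n - int (card {q \<in> D. P q = k})))
     = (\<Prod>k\<in>K. int_fact (int n - int (card I) - int (card J)
        + (\<Sum>a\<in>I. \<Sum>b\<in>J. of_bool (P (a, b) = k))))"
    using fibre by (intro prod.cong refl arg_cong[of _ _ int_fact]) simp
  ultimately show ?thesis unfolding count I_def J_def K_def by simp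
qed

text \<open>A row line and a column line agree at their crossing iff, as index-direction pairs, they lie in
  one orbit of the involution \<open>(i, d) \<mapsto> (n + 1 - i, \<not> d)\<close>.\<close>
lemma line_entry_eq_orbit_iff:
  assumes "i \<in> {1..n}" "j \<in> {1..n}" "r \<in> {1..n}" "line_entry n d j = line_entry n e i"
  shows "(i, d) \<in> {(r, False), (n + 1 - r, True)} \<longleftrightarrow> (j, e) \<in> {(r, False), (n + 1 - r, True)}"
  using assms by (cases d; cases e) (auto simp: line_entry_def)

text \<open>For \<open>n \<ge> 2\<close> the two directions already differ in the first entry,
  \<open>1\<close> against \<open>n\<close>; for \<open>n = 1\<close> they coincide.\<close>

lemma row_lines_functional:
  assumes "n \<ge> 2" "(i, d) \<in> row_lines n A" "(i, e) \<in> row_lines n A"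
  shows "d = e"
proof -
  have "line_entry n d 1 = line_entry n e 1" using assms by (auto simp: row_lines_def)
  then show ?thesis using assms(1) by (auto simp: line_entry_def split: if_splits)
qed

lemma col_lines_functional:
  assumes "n \<ge> 2" "(i, d) \<in> col_lines n A" "(i, e) \<in> col_lines n A"
  shows "d = e"
proof -
  have "line_entry n d 1 = line_entry n e 1" using assms by (auto simp: col_lines_def)
  then show ?thesis using assms(1) by (auto simp: line_entry_def split: if_splits)
qed

text \<open>In such a square each index of \<open>I\<close> has exactly one of two directions, so
  the set is a disjoint union over \<open>2 ^ card I\<close> choices \<open>d\<close>. Each choice
  is counted by \<open>line_count_eq\<close> with no column lines, where no crossing corrects the
  factors.\<close>

lemma card_row_lines_superset:
  assumes "n \<ge> 2" "I \<subseteq> {1..n}"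
  shows "real (card {A \<in> equi_squares n. I \<subseteq> fst ` row_lines n A}) =
    2 ^ card I * (int_fact (int n ^ 2 - int (card I) * int n) / int_fact (int n - int (card I)) ^ n)"
proof -
  define g where "g = (\<lambda>d. (\<lambda>i. (i, d i)) ` I :: (nat \<times> bool) set)"
  define F where "F = (\<lambda>d. {A \<in> equi_squares n. g d \<subseteq> row_lines n A \<and> {} \<subseteq> col_lines n A})"
  have finI: "finite I" using assms finite_subset by auto
  have "{A \<in> equi_squares n. I \<subseteq> fst ` row_lines n A} = (\<Union>d\<in>I \<rightarrow>\<^sub>E UNIV. F d)"
  proof (intro set_eqI iffI)
    fix A assume A: "A \<in> {A \<in> equi_squares n. I \<subseteq> fst ` row_lines n A}"
    then have "\<forall>i\<in>I. \<exists>d. (i, d) \<in> row_lines n A" by force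
    then obtain d where "\<forall>i\<in>I. (i, d i) \<in> row_lines n A" by metis
    \<comment> \<open>Restricting the choice function makes it extensional, so that it lies in the
      finite index set of the union.\<close>
    then have "A \<in> F (restrict d I)" "restrict d I \<in> I \<rightarrow>\<^sub>E UNIV" using A by (auto simp: F_def g_def)
    then show "A \<in> (\<Union>d\<in>I \<rightarrow>\<^sub>E UNIV. F d)" by blast
  next
    fix A assume "A \<in> (\<Union>d\<in>I \<rightarrow>\<^sub>E UNIV. F d)"
    then obtain d where d: "A \<in> F d" by blast
    have "i \<in> fst ` row_lines n A" if "i \<in> I" for i
    proof (rule image_eqI)
      show "(i, d i) \<in> row_lines n A" using d that by (auto simp: F_def g_def)
    qed simp
    then show "A \<in> {A \<in> equi_squares n. I \<subseteq> fst ` row_lines n A}" using d by (auto simp: F_def)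
  qed
  moreover have "card (\<Union>d\<in>I \<rightarrow>\<^sub>E UNIV. F d) = (\<Sum>d\<in>I \<rightarrow>\<^sub>E UNIV. card (F d))"
  proof (rule card_UN_disjoint)
    show "\<forall>d\<in>I \<rightarrow>\<^sub>E UNIV. \<forall>e\<in>I \<rightarrow>\<^sub>E UNIV. d \<noteq> e \<longrightarrow> F d \<inter> F e = {}"
    proof (intro ballI impI)
      fix d e :: "nat \<Rightarrow> bool" assume de: "d \<in> I \<rightarrow>\<^sub>E UNIV" "e \<in> I \<rightarrow>\<^sub>E UNIV" "d \<noteq> e"
      then obtain i where i: "i \<in> I" "d i \<noteq> e i" using PiE_ext[OF de(1,2)] by blast
      have "(i, d i) \<in> row_lines n A" if "A \<in> F d" for A d
        using that i(1) by (auto simp: F_def g_def)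
      then show "F d \<inter> F e = {}" using row_lines_functional[OF assms(1)] i(2) by blast
    qed
  qed (simp_all add: F_def finI finite_equi_squares finite_PiE)
  moreover have "real (card (F d)) = int_fact (int n ^ 2 - int (card I) * int n) / int_fact (int n - int (card I)) ^ n"
    for d
  proof -
    have "fst ` g d = I" by (force simp: g_def)
    then show ?thesis
      using line_count_eq[of "g d" n "\<lambda>(i, j). line_entry n (d i) j" "{}"] assms(2)
      by (auto simp: line_count_def F_def g_def mult.commute)
  qed
  ultimately show ?thesis using finI by (simp add: card_funcsetE)
qed

text \<open>Transposition preserves the fibre sizes and exchanges row lines with column lines.
  Restricting it to the index square keeps arrays extensional and makes it an involution on
  equi-squares.\<close>

lemma card_transpose:
  "card {A \<in> equi_squares n. col_lines n A \<noteq> {}} = card {A \<in> equi_squares n. row_lines n A \<noteq> {}}"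
proof (rule bij_betw_same_card)
  let ?X = "{1..n} \<times> {1..n}"
  define t :: "(nat \<times> nat \<Rightarrow> nat) \<Rightarrow> nat \<times> nat \<Rightarrow> nat"
    where "t = (\<lambda>A. restrict (\<lambda>p. A (prod.swap p)) ?X)"
  have t_equi: "t A \<in> equi_squares n" if "A \<in> equi_squares n" for A
  proof -
    have "card {p \<in> ?X. t A p = k} = card {p \<in> ?X. A p = k}" for k
      by (rule bij_betw_same_card[of prod.swap], rule bij_betwI[where g = prod.swap]) (auto simp: t_def)
    then show ?thesis using that by (auto simp: equi_squares_def t_def)
  qed
  have t_t: "t (t A) = A" if "A \<in> equi_squares n" for A
    using that by (auto simp: equi_squares_def t_def fun_eq_iff PiE_iff extensional_def)
  have lines: "row_lines n (t A) = col_lines n A" "col_lines n (t A) = row_lines n A" for A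
    by (auto simp: row_lines_def col_lines_def t_def)
  show "bij_betw t {A \<in> equi_squares n. col_lines n A \<noteq> {}} {A \<in> equi_squares n. row_lines n A \<noteq> {}}"
    by (rule bij_betwI[where g = t]) (auto simp: t_equi t_t lines)
qed

text \<open>Inclusion-exclusion runs over row indices rather than directed lines, and grouping by
  size gives \<open>n choose i\<close>. The factor 2, which will account for rows and columns
  together, turns \<open>(-1) ^ (i + 1) * 2 ^ i\<close> into \<open>(-2) ^ (i + 1)\<close>.\<close>

lemma card_row_lines_nonempty:
  assumes "n \<ge> 2"
  shows "2 * real (card {A \<in> equi_squares n. row_lines n A \<noteq> {}}) =
    (\<Sum>i=1..n. (-2) ^ (i + 1) * real (n choose i) *
            (int_fact (int n ^ 2 - int i * int n) / int_fact (int n - int i) ^ n))"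
proof -
  define f where "f = (\<lambda>i. int_fact (int n ^ 2 - int i * int n) / int_fact (int n - int i) ^ n)"
  let ?S = "{B. B \<subseteq> {1..n} \<and> B \<noteq> {}}"
  have "{A \<in> equi_squares n. row_lines n A \<noteq> {}} = {A \<in> equi_squares n. fst ` row_lines n A \<noteq> {}}" by auto
  then have "real (card {A \<in> equi_squares n. row_lines n A \<noteq> {}})
     = real (card {A \<in> equi_squares n. fst ` row_lines n A \<noteq> {}})" by simp
  also have "\<dots>
     = (\<Sum>B\<in>?S. (-1) ^ (card B + 1) * real (card {A \<in> equi_squares n. B \<subseteq> fst ` row_lines n A}))"
    using finite_equi_squares by (intro sum_nonempty_subsets) (auto simp: row_lines_def)
  also have "\<dots> = (\<Sum>B\<in>?S. (-1) ^ (card B + 1) * (2 ^ card B * f (card B)))"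
    using card_row_lines_superset[OF assms] by (intro sum.cong) (auto simp: f_def)
  also have "\<dots> = (\<Sum>i=1..n. \<Sum>B\<in>{B \<in> ?S. card B = i}. (-1) ^ (card B + 1) * (2 ^ card B * f (card B)))"
  proof (rule sum.group[symmetric])
    show "card ` ?S \<subseteq> {1..n}"
    proof
      fix k assume "k \<in> card ` ?S"
      then obtain B where B: "B \<subseteq> {1..n}" "B \<noteq> {}" "k = card B" by auto
      then have "card B \<noteq> 0" by (meson card_0_eq finite_atLeastAtMost finite_subset)
      moreover have "card B \<le> n" using B card_mono[of "{1..n}" B] by simp
      ultimately show "k \<in> {1..n}" using B by simp
    qed
  qed auto
  also have "\<dots> = (\<Sum>i=1..n. real (n choose i) * ((-1) ^ (i + 1) * (2 ^ i * f i)))"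
  proof (rule sum.cong[OF refl])
    fix i assume i: "i \<in> {1..n}"
    have "{B \<in> ?S. card B = i} = {B. B \<subseteq> {1..n} \<and> card B = i}" using i by auto
    then have "card {B \<in> ?S. card B = i} = n choose i" using n_subsets[of "{1..n}" i] by simp
    then show "(\<Sum>B\<in>{B \<in> ?S. card B = i}. (-1) ^ (card B + 1) * (2 ^ card B * f (card B)))
       = real (n choose i) * ((-1) ^ (i + 1) * (2 ^ i * f i))" by simp
  qed
  finally have "2 * real (card {A \<in> equi_squares n. row_lines n A \<noteq> {}}) = 
      (\<Sum>i=1..n. 2 * (real (n choose i) * ((-1) ^ (i + 1) * (2 ^ i * f i))))"
    by (simp only: sum_distrib_left)
  also have "\<dots> = (\<Sum>i=1..n. (-2) ^ (i + 1) * real (n choose i) * f i)"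
  proof (rule sum.cong[OF refl])
    fix i
    have "(-2 :: real) ^ (i + 1) = (-1) ^ (i + 1) * 2 ^ (i + 1)" by (simp flip: power_mult_distrib)
    then show "2 * (real (n choose i) * ((-1) ^ (i + 1) * (2 ^ i * f i))) = (-2) ^ (i + 1) * real (n choose i) * f i"
      by simp
  qed
  finally show ?thesis unfolding f_def .
qed

section \<open>Squares with a consecutive row and a consecutive column\<close>

lemma prod_one_exceptional:
  fixes g :: "'a \<Rightarrow> 'b :: comm_monoid_mult"
  assumes "finite K" "v \<in> K" "g v = a" "\<And>k. k \<in> K \<Longrightarrow> k \<noteq> v \<Longrightarrow> g k = b"
  shows "prod g K = a * b ^ (card K - 1)"
proof -
  have "prod g K = g v * prod g (K - {v})" using assms by (simp add: prod.remove)
  also have "prod g (K - {v}) = (\<Prod>k\<in>K - {v}. b)" using assms by (intro prod.cong) auto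
  finally show ?thesis using assms by simp
qed

lemma prod_two_exceptional:
  fixes g :: "'a \<Rightarrow> 'b :: comm_monoid_mult"
  assumes "finite K" "v \<in> K" "w \<in> K" "v \<noteq> w" "g v = a" "g w = a"
    "\<And>k. k \<in> K \<Longrightarrow> k \<noteq> v \<Longrightarrow> k \<noteq> w \<Longrightarrow> g k = b"
  shows "prod g K = a * a * b ^ (card K - 2)"
proof -
  have "prod g (K - {v}) = a * b ^ (card (K - {v}) - 1)"
    using assms by (intro prod_one_exceptional[of _ w]) auto
  then show ?thesis using assms by (simp add: prod.remove[of K v] numeral_2_eq_2 mult.assoc)
qed

text \<open>One row and one column that agree at their crossing: \<open>(n - 1)\<^sup>2\<close>
  cells stay free, the symbol at the crossing has \<open>n - 1\<close> occurrences left, and every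
  other symbol has \<open>n - 2\<close>.\<close>

definition cross_count :: "nat \<Rightarrow> real" where
  "cross_count n = int_fact (int n ^ 2 - 2 * int n + 1)
            / (int_fact (int n - 1) * int_fact (int n - 2) ^ (n - 1))"

text \<open>Two parallel lines and one perpendicular line of the same orbit:
  \<open>(n - 1) (n - 2)\<close> cells stay free, and the two crossings carry different symbols,
  each with \<open>n - 3 + 1\<close> occurrences left.\<close>

definition three_line_count :: "nat \<Rightarrow> real" where
  "three_line_count n = int_fact (int n ^ 2 - 3 * int n + 2)
            / (int_fact (int n - 2) ^ 2 * int_fact (int n - 3) ^ (n - 2))"

text \<open>Two rows and two columns of the same orbit: \<open>(n - 2)\<^sup>2\<close> cells stay
  free, and the four crossings carry two symbols twice each, which leaves \<open>n - 4 + 2\<close>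
  occurrences of these.\<close>

definition four_line_count :: "nat \<Rightarrow> real" where
  "four_line_count n = int_fact (int n ^ 2 - 4 * int n + 4)
            / (int_fact (int n - 2) ^ 2 * int_fact (int n - 4) ^ (n - 2))"

lemma line_count_cross:
  assumes "i \<in> {1..n}" "j \<in> {1..n}" "line_entry n d j = line_entry n e i"
  shows "real (line_count n {(i, d)} {(j, e)}) = cross_count n"
proof -
  \<comment> \<open>The pattern follows the row line in row \<open>i\<close> and the column line
    everywhere else; by hypothesis the two agree at \<open>(i, j)\<close>.\<close>
  let ?P = "\<lambda>(a, b). if a = i then line_entry n d b else line_entry n e a"
  have "(\<Prod>k\<in>{1..n}. int_fact (int n - 2 + of_bool (line_entry n d j = k)))
     = int_fact (int n - 1) * int_fact (int n - 2) ^ (card {1..n} - 1)"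
    using assms(2) by (intro prod_one_exceptional[of _ "line_entry n d j"]) (auto simp: line_entry_def)
  then show ?thesis
    using line_count_eq[of "{(i, d)}" n ?P "{(j, e)}"] assms
    by (simp add: cross_count_def algebra_simps del: sum_of_bool_eq)
qed

definition line_orbit :: "nat \<Rightarrow> nat \<Rightarrow> (nat \<times> bool) set" where
  "line_orbit n r = {(r, False), (n + 1 - r, True)}"

text \<open>Off the centre the orbit occupies two distinct indices \<open>r\<close> and
  \<open>s = n + 1 - r\<close>. The crossings \<open>(r, r)\<close> and \<open>(s, s)\<close> carry
  the symbol \<open>r\<close>, and \<open>(r, s)\<close> and \<open>(s, r)\<close> carry
  \<open>s\<close>.\<close>

lemma line_count_orbit:
  assumes r: "r \<in> {1..n}" "r \<noteq> n + 1 - r"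
  defines "x \<equiv> (r, False)" and "y \<equiv> (n + 1 - r, True)"
  shows "real (line_count n {x, y} {x}) = three_line_count n"
    and "real (line_count n {x, y} {y}) = three_line_count n"
    and "real (line_count n {x} {x, y}) = three_line_count n"
    and "real (line_count n {y} {x, y}) = three_line_count n"
    and "real (line_count n {x, y} {x, y}) = four_line_count n"
proof -
  define s where "s = n + 1 - r"
  \<comment> \<open>Rows \<open>r\<close> and \<open>s\<close> follow the row lines. Elsewhere the
    column lines decide, ascending in column \<open>r\<close> and descending in column
    \<open>s\<close>.\<close>
  let ?P = "\<lambda>(a, b). if a = r then b else if a = s then n + 1 - b else if b = r then a else n + 1 - a"
  have rs: "r \<noteq> s" "s \<noteq> r" "s \<in> {1..n}" "Suc n - s = r" "Suc n - r = s" using r by (auto simp: s_def)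
  have three: "(\<Prod>k\<in>{1..n}. int_fact (int n - 3 + (of_bool (r = k) + of_bool (s = k))))
     = int_fact (int n - 2) * int_fact (int n - 2) * int_fact (int n - 3) ^ (card {1..n} - 2)"
    using r rs by (intro prod_two_exceptional[of _ r s]) auto
  have four: "(\<Prod>k\<in>{1..n}. int_fact (int n - 4 + (2 * of_bool (r = k) + 2 * of_bool (s = k))))
     = int_fact (int n - 2) * int_fact (int n - 2) * int_fact (int n - 4) ^ (card {1..n} - 2)"
    using r rs by (intro prod_two_exceptional[of _ r s]) auto
  have count: "real (line_count n S T) =
    int_fact (int n ^ 2 - int n * (int (card (fst ` S)) + int (card (fst ` T)))
        + int (card (fst ` S)) * int (card (fst ` T)))
    / (\<Prod>k\<in>{1..n}. int_fact (int n - int (card (fst ` S)) - int (card (fst ` T))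
        + (\<Sum>a\<in>fst ` S. \<Sum>b\<in>fst ` T. of_bool (?P (a, b) = k))))"
    if "S \<subseteq> {x, y}" "T \<subseteq> {x, y}" for S T
  proof (rule line_count_eq)
    show "?P (i, j) = line_entry n d j" if "(i, d) \<in> S" "j \<in> {1..n}" for i d j
      using that \<open>S \<subseteq> {x, y}\<close> rs by (auto simp: x_def y_def line_entry_def)
    show "?P (i, j) = line_entry n d i" if "(j, d) \<in> T" "i \<in> {1..n}" for i d j
    proof -
      have "(j = r \<and> \<not> d) \<or> (j = s \<and> d)"
        using that(1) \<open>T \<subseteq> {x, y}\<close> rs by (auto simp: x_def y_def)
      then show ?thesis using rs by (auto simp: line_entry_def)
    qed
  qed (use that r rs in \<open>auto simp: x_def y_def\<close>)
  have y_eq: "y = (s, True)" by (simp add: y_def s_def)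
  note simps = x_def y_eq rs three_line_count_def four_line_count_def power2_eq_square
  show "real (line_count n {x, y} {x}) = three_line_count n"
    using count[of "{x, y}" "{x}"] three by (simp add: simps algebra_simps del: sum_of_bool_eq)
  show "real (line_count n {x, y} {y}) = three_line_count n"
    using count[of "{x, y}" "{y}"] three by (simp add: simps algebra_simps del: sum_of_bool_eq)
  show "real (line_count n {x} {x, y}) = three_line_count n"
    using count[of "{x}" "{x, y}"] three by (simp add: simps algebra_simps del: sum_of_bool_eq)
  show "real (line_count n {y} {x, y}) = three_line_count n"
    using count[of "{y}" "{x, y}"] three by (simp add: simps algebra_simps del: sum_of_bool_eq)
  show "real (line_count n {x, y} {x, y}) = four_line_count n"
    using count[of "{x, y}" "{x, y}"] four by (simp add: simps algebra_simps del: sum_of_bool_eq)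
qed

section \<open>Which sets of lines can occur together\<close>

lemma line_count_contradictory:
  assumes "n \<ge> 2" "{(i, False), (i, True)} \<subseteq> S \<or> {(i, False), (i, True)} \<subseteq> T"
  shows "line_count n S T = 0"
proof -
  have "{A \<in> equi_squares n. S \<subseteq> row_lines n A \<and> T \<subseteq> col_lines n A} = {}"
  proof (rule equals0I)
    fix A assume "A \<in> {A \<in> equi_squares n. S \<subseteq> row_lines n A \<and> T \<subseteq> col_lines n A}"
    then have "(i, False) \<in> row_lines n A \<and> (i, True) \<in> row_lines n A
        \<or> (i, False) \<in> col_lines n A \<and> (i, True) \<in> col_lines n A"
      using assms(2) by auto
    then show False using row_lines_functional[OF assms(1)] col_lines_functional[OF assms(1)] by metis
  qed
  then show ?thesis by (simp only: line_count_def card.empty)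
qed

text \<open>Orbit membership transfers across every crossing. Hence one line of \<open>S\<close>
  pulls all of \<open>T\<close> into its orbit, and then one line of \<open>T\<close> pulls in all
  of \<open>S\<close>; this is where both sets must be nonempty.\<close>

lemma line_count_nonzero_imp_orbit:
  assumes "line_count n S T \<noteq> 0" "S \<noteq> {}" "T \<noteq> {}"
  shows "\<exists>r\<in>{1..n}. S \<subseteq> line_orbit n r \<and> T \<subseteq> line_orbit n r"
proof -
  obtain A where A: "S \<subseteq> row_lines n A" "T \<subseteq> col_lines n A"
    using assms(1) unfolding line_count_def by (metis (no_types, lifting) card.empty empty_Collect_eq)
  have orbit_iff: "x \<in> line_orbit n r \<longleftrightarrow> y \<in> line_orbit n r" if xy: "x \<in> S" "y \<in> T" and r: "r \<in> {1..n}" for x y r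
  proof -
    obtain i d j e where *: "x = (i, d)" "y = (j, e)" by fastforce
    then have mem: "(i, d) \<in> row_lines n A" "(j, e) \<in> col_lines n A" using xy A by auto
    then have ij: "i \<in> {1..n}" "j \<in> {1..n}" by (auto simp: row_lines_def col_lines_def)
    have "A (i, j) = line_entry n d j"
      using mem(1) ij by (simp add: row_lines_def)
    moreover have "A (i, j) = line_entry n e i"
      using mem(2) ij by (simp add: col_lines_def)
    ultimately show ?thesis using line_entry_eq_orbit_iff[OF ij r, of d e] * by (simp add: line_orbit_def)
  qed
  obtain i d where x: "(i, d) \<in> S" using assms(2) by fastforce
  obtain y where y: "y \<in> T" using assms(3) by blast
  \<comment> \<open>An ascending line at \<open>i\<close> lies in the orbit of \<open>i\<close>, a
    descending one in the orbit of \<open>n + 1 - i\<close>.\<close>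
  define r where "r = line_entry n d i"
  have "i \<in> {1..n}" using x A(1) row_lines_subset[of n A] by blast
  then have r: "r \<in> {1..n}" "(i, d) \<in> line_orbit n r"
    by (auto simp: r_def line_entry_def line_orbit_def)
  have "T \<subseteq> line_orbit n r" using orbit_iff[OF x _ r(1)] r(2) by blast
  moreover have "S \<subseteq> line_orbit n r" using orbit_iff[OF _ y r(1)] calculation y by blast
  ultimately show ?thesis using r(1) by blast
qed

lemma line_orbit_disjoint:
  assumes "r \<in> {1..n}" "s \<in> {1..n}" "r \<noteq> s"
  shows "line_orbit n r \<inter> line_orbit n s = {}"
  using assms by (auto simp: line_orbit_def)

text \<open>Inclusion-exclusion is applied twice, first over sets \<open>T\<close> of column lines
  and then over sets \<open>S\<close> of row lines. Here the sets consist of directed lines, because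
  compatibility depends on the directions.\<close>

lemma card_row_and_col_lines:
  assumes n: "n \<ge> 2"
  shows "real (card {A \<in> equi_squares n. row_lines n A \<noteq> {} \<and> col_lines n A \<noteq> {}}) =
    4 * real n * cross_count n - 8 * real (n div 2) * three_line_count n
      + 2 * real (n div 2) * four_line_count n"
proof -
  let ?L = "{1..n} \<times> (UNIV :: bool set)"
  let ?S = "{B. B \<subseteq> ?L \<and> B \<noteq> {}}"
  define orbit_sets where "orbit_sets = (\<lambda>r. {B. B \<subseteq> line_orbit n r \<and> B \<noteq> {}})"
  define F where "F = (\<lambda>S T. (-1) ^ (card S + card T) * real (line_count n S T))"
  have "real (card {A \<in> equi_squares n. row_lines n A \<noteq> {} \<and> col_lines n A \<noteq> {}}) = 
     real (card {A \<in> {A \<in> equi_squares n. row_lines n A \<noteq> {}}. col_lines n A \<noteq> {}})"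
    by (intro arg_cong[of _ _ "\<lambda>X. real (card X)"]) auto
  also have "\<dots> = (\<Sum>T\<in>?S. (-1) ^ (card T + 1) *
      real (card {A \<in> {A \<in> equi_squares n. row_lines n A \<noteq> {}}. T \<subseteq> col_lines n A}))"
    using col_lines_subset finite_equi_squares by (intro sum_nonempty_subsets) auto
  \<comment> \<open>Exchanging the two conditions prepares the inclusion-exclusion over row lines
    for fixed \<open>T\<close>.\<close>
  also have "\<dots> = (\<Sum>T\<in>?S. (-1) ^ (card T + 1) *
      real (card {A \<in> {A \<in> equi_squares n. T \<subseteq> col_lines n A}. row_lines n A \<noteq> {}}))"
    by (intro sum.cong refl arg_cong2[of _ _ _ _ "(*)"] arg_cong[of _ _ "\<lambda>X. real (card X)"]) auto
  also have "\<dots> = (\<Sum>T\<in>?S. (-1) ^ (card T + 1) *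
      (\<Sum>S\<in>?S. (-1) ^ (card S + 1) *
      real (card {A \<in> {A \<in> equi_squares n. T \<subseteq> col_lines n A}. S \<subseteq> row_lines n A})))"
    using row_lines_subset finite_equi_squares
    by (intro sum.cong refl arg_cong2[of _ _ _ _ "(*)"] sum_nonempty_subsets) auto
  also have "\<dots> = (\<Sum>T\<in>?S. \<Sum>S\<in>?S. F S T)"
    unfolding sum_distrib_left F_def line_count_def
    by (intro sum.cong refl) (auto simp: power_add intro!: arg_cong[of _ _ card])
  also have "\<dots> = (\<Sum>(T, S)\<in>?S \<times> ?S. F S T)"
    by (rule sum.cartesian_product)
  also have "\<dots> = (\<Sum>(T, S)\<in>(\<Union>r\<in>{1..n}. orbit_sets r \<times> orbit_sets r). F S T)"
  proof (rule sum.mono_neutral_right)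
    have "line_orbit n r \<subseteq> ?L" if "r \<in> {1..n}" for r using that by (auto simp: line_orbit_def)
    then show "(\<Union>r\<in>{1..n}. orbit_sets r \<times> orbit_sets r) \<subseteq> ?S \<times> ?S" unfolding orbit_sets_def by blast
    show "\<forall>p\<in>?S \<times> ?S - (\<Union>r\<in>{1..n}. orbit_sets r \<times> orbit_sets r). (case p of (T, S) \<Rightarrow> F S T) = 0"
    proof
      fix p assume p: "p \<in> ?S \<times> ?S - (\<Union>r\<in>{1..n}. orbit_sets r \<times> orbit_sets r)"
      obtain T S where TS: "p = (T, S)" by fastforce
      have "S \<noteq> {}" "T \<noteq> {}" "\<not> (\<exists>r\<in>{1..n}. S \<subseteq> line_orbit n r \<and> T \<subseteq> line_orbit n r)"
        using p unfolding TS orbit_sets_def by auto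
      then have "line_count n S T = 0" using line_count_nonzero_imp_orbit by blast
      then show "(case p of (T, S) \<Rightarrow> F S T) = 0" by (simp add: F_def TS)
    qed
  qed auto
  also have "\<dots> = (\<Sum>r\<in>{1..n}. \<Sum>(T, S)\<in>orbit_sets r \<times> orbit_sets r. F S T)"
  proof (rule sum.UNION_disjoint)
    show "\<forall>r\<in>{1..n}. \<forall>s\<in>{1..n}. r \<noteq> s \<longrightarrow> (orbit_sets r \<times> orbit_sets r) \<inter> (orbit_sets s \<times> orbit_sets s) = {}"
      using line_orbit_disjoint unfolding orbit_sets_def by blast
  qed (auto simp: orbit_sets_def line_orbit_def)
  also have "\<dots> = (\<Sum>r\<in>{1..n}. 4 * cross_count n
      + of_bool (r \<noteq> n + 1 - r) * (four_line_count n - 4 * three_line_count n))"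
  proof (rule sum.cong[OF refl])
    fix r assume r: "r \<in> {1..n}"
    define x y where "x = (r, False)" and "y = (n + 1 - r, True)"
    have "x \<noteq> y" by (simp add: x_def y_def)
    have O_eq: "orbit_sets r = {{x}, {y}, {x, y}}"
      by (auto simp: orbit_sets_def line_orbit_def x_def y_def)
    have cross: "line_count n {x} {x} = cross_count n" "line_count n {x} {y} = cross_count n"
      "line_count n {y} {x} = cross_count n" "line_count n {y} {y} = cross_count n"
      unfolding x_def y_def by (rule line_count_cross; use r in \<open>auto simp: line_entry_def\<close>)+
    have "(\<Sum>(T, S)\<in>orbit_sets r \<times> orbit_sets r. F S T) = (\<Sum>T\<in>orbit_sets r. \<Sum>S\<in>orbit_sets r. F S T)"
      by (simp add: sum.cartesian_product)
    \<comment> \<open>Nine pairs of nonempty subsets of \<open>{x, y}\<close>: four of sizes 1 and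
      1, four of sizes 1 and 2 with negative sign, and one of sizes 2 and 2.\<close>
    also have "\<dots> = 4 * cross_count n + line_count n {x, y} {x, y}
        - (line_count n {x, y} {x} + line_count n {x, y} {y} + line_count n {x} {x, y} + line_count n {y} {x, y})"
      using \<open>x \<noteq> y\<close> \<open>x \<noteq> y\<close>[symmetric] by (simp add: O_eq F_def cross doubleton_eq_iff insert_eq_iff)
    also have "\<dots> = 4 * cross_count n
      + of_bool (r \<noteq> n + 1 - r) * (four_line_count n - 4 * three_line_count n)"
    proof (cases "r = n + 1 - r")
      \<comment> \<open>The central orbit, which exists only for odd \<open>n\<close>, is one row in
        both directions, so every term containing \<open>{x, y}\<close> vanishes.\<close>
      case True
      then have "{x, y} = {(r, False), (r, True)}" by (simp add: x_def y_def)
      then show ?thesis using True line_count_contradictory[OF n, of r] by simp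
    next
      case False
      then show ?thesis using line_count_orbit[OF r False] by (simp add: x_def y_def)
    qed
    finally show "(\<Sum>(T, S)\<in>orbit_sets r \<times> orbit_sets r. F S T) = 4 * cross_count n
      + of_bool (r \<noteq> n + 1 - r) * (four_line_count n - 4 * three_line_count n)" .
  qed
  also have "\<dots> = 4 * real n * cross_count n
      + real (card {r \<in> {1..n}. r \<noteq> n + 1 - r}) * (four_line_count n - 4 * three_line_count n)"
    by (simp add: sum.distrib Int_def flip: sum_distrib_right)
  \<comment> \<open>For odd \<open>n\<close> the middle index drops out. The form
    \<open>2 * (n div 2)\<close> covers both parities and yields the coefficients 8 and 2.\<close>
  also have "card {r \<in> {1..n}. r \<noteq> n + 1 - r} = 2 * (n div 2)"
  proof (cases "even n")
    case True
    then have "{r \<in> {1..n}. r \<noteq> n + 1 - r} = {1..n}" by (auto elim!: evenE) presburger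
    then show ?thesis using True by simp
  next
    case False
    then obtain k where k: "n = 2 * k + 1" by (auto elim: oddE)
    then have "{r \<in> {1..n}. r \<noteq> n + 1 - r} = {1..n} - {k + 1}" by auto
    then show ?thesis using k by simp
  qed
  finally show ?thesis by (simp add: algebra_simps)
qed

section \<open>Combining rows and columns\<close>

lemma card_consecutive_equi_squares:
  "real (card (consecutive_equi_squares n)) = 2 * real (card {A \<in> equi_squares n. row_lines n A \<noteq> {}})
     - real (card {A \<in> equi_squares n. row_lines n A \<noteq> {} \<and> col_lines n A \<noteq> {}})"
proof -
  let ?R = "{A \<in> equi_squares n. row_lines n A \<noteq> {}}" and ?C = "{A \<in> equi_squares n. col_lines n A \<noteq> {}}"
  have "consecutive_equi_squares n = ?R \<union> ?C"
    "{A \<in> equi_squares n. row_lines n A \<noteq> {} \<and> col_lines n A \<noteq> {}} = ?R \<inter> ?C"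
    unfolding consecutive_equi_squares_eq by auto
  then have "card (consecutive_equi_squares n)
      + card {A \<in> equi_squares n. row_lines n A \<noteq> {} \<and> col_lines n A \<noteq> {}} = card ?R + card ?C"
    using card_Un_Int[of ?R ?C] finite_equi_squares[of n] by simp
  then show ?thesis using card_transpose[of n] by linarith
qed

section \<open>Asymptotics\<close>

text \<open>The factors \<open>m + 1, ..., m + k\<close> that extend \<open>fact m\<close> to
  \<open>fact (m + k)\<close> are all at least \<open>m + 1\<close>.\<close>

lemma fact_mult_power_le_fact: "fact m * real (m + 1) ^ k \<le> fact (m + k)"
proof (induction k)
  case (Suc k)
  have "fact m * real (m + 1) ^ Suc k = real (m + 1) * (fact m * real (m + 1) ^ k)" by simp
  also have "\<dots> \<le> real (m + k + 1) * fact (m + k)"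
    using Suc.IH by (intro mult_mono) auto
  finally show ?case by simp
qed simp

text \<open>For \<open>i \<le> n\<close>, the number of equi-squares in which \<open>i\<close> given
  rows are prescribed with given directions.\<close>

definition rows_count :: "nat \<Rightarrow> nat \<Rightarrow> real" where
  "rows_count n i = int_fact (int n ^ 2 - int i * int n) / int_fact (int n - int i) ^ n"

lemma rows_count_1_pos:
  assumes "n \<ge> 1"
  shows "rows_count n 1 > 0"
proof -
  have "n \<le> n ^ 2" by (simp add: power2_eq_square)
  then have "int n \<le> int n ^ 2" by (metis of_nat_le_iff of_nat_power)
  then show ?thesis using assms by (simp add: rows_count_def int_fact_def)
qed

lemma int_fact_of_nat: "int_fact (int m) = fact m"
  by (simp add: int_fact_def)

text \<open>A second prescribed row removes \<open>n\<close> factors of size at least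
  \<open>(n - 1)\<^sup>2\<close> from the numerator, but only \<open>(n - 1) ^ n\<close> from the
  denominator. For a prescribed column the same holds with \<open>n - 1\<close> in place of
  \<open>n\<close> as the number of factors and as the exponent.\<close>

lemma two_rows_and_cross_count_le:
  assumes "n \<ge> 2"
  shows "rows_count n 2 * real (n - 1) ^ n \<le> rows_count n 1"
    and "cross_count n * real (n - 1) ^ (n - 1) \<le> rows_count n 1"
proof -
  obtain k where n: "n = k + 2" using assms by (metis add.commute le_Suc_ex)
  have r1: "rows_count n 1 = fact ((k + 1) * (k + 2)) / fact (k + 1) ^ (k + 2)"
  proof -
    have "int n ^ 2 - int 1 * int n = int ((k + 1) * (k + 2))" "int n - int 1 = int (k + 1)"
      by (simp_all add: n power2_eq_square algebra_simps)
    then show ?thesis unfolding rows_count_def by (simp only: int_fact_of_nat n)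
  qed
  have r2: "rows_count n 2 = fact (k * (k + 2)) / fact k ^ (k + 2)"
  proof -
    have "int n ^ 2 - int 2 * int n = int (k * (k + 2))" "int n - int 2 = int k"
      by (simp_all add: n power2_eq_square algebra_simps)
    then show ?thesis unfolding rows_count_def by (simp only: int_fact_of_nat n)
  qed
  have c: "cross_count n = fact ((k + 1) ^ 2) / (fact (k + 1) * fact k ^ (k + 1))"
  proof -
    have "int n ^ 2 - 2 * int n + 1 = int ((k + 1) ^ 2)" "int n - 1 = int (k + 1)" "int n - 2 = int k" "n - 1 = k + 1"
      by (simp_all add: n power2_eq_square algebra_simps)
    then show ?thesis unfolding cross_count_def by (simp only: int_fact_of_nat)
  qed
  have n1: "n - 1 = k + 1" by (simp add: n)
  define q where "q = real (k + 1)"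
  have q: "q > 0" by (simp add: q_def)
  have fact_k1: "fact (k + 1) = q * (fact k :: real)" by (simp add: q_def)
  have "fact (k * (k + 2)) * (q ^ 2) ^ (k + 2) \<le> fact ((k + 1) * (k + 2))"
  proof -
    have "real (k * (k + 2) + 1) = q ^ 2" by (simp add: q_def power2_eq_square algebra_simps)
    moreover have "k * (k + 2) + (k + 2) = (k + 1) * (k + 2)" by simp
    ultimately show ?thesis using fact_mult_power_le_fact[of "k * (k + 2)" "k + 2"] by (simp only:)
  qed
  then have "fact (k * (k + 2)) * (q ^ 2) ^ (k + 2) / (q * fact k) ^ (k + 2)
      \<le> fact ((k + 1) * (k + 2)) / (q * fact k) ^ (k + 2)"
    using q by (intro divide_right_mono) auto
  moreover have "fact (k * (k + 2)) * (q ^ 2) ^ (k + 2) / (q * fact k) ^ (k + 2)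
      = fact (k * (k + 2)) / fact k ^ (k + 2) * q ^ (k + 2)"
    using q by (simp add: power2_eq_square power_mult_distrib field_simps)
  ultimately show "rows_count n 2 * real (n - 1) ^ n \<le> rows_count n 1"
    unfolding r1 r2 fact_k1 n1 q_def[symmetric] by (simp add: n)
  have "fact ((k + 1) ^ 2) * (q ^ 2) ^ (k + 1) \<le> fact ((k + 1) * (k + 2))"
  proof -
    \<comment> \<open>Unlike in the case of two rows, the smallest added factor is
      \<open>q\<^sup>2 + 1\<close>; it is rounded down to \<open>q\<^sup>2\<close>.\<close>
    have "fact ((k + 1) ^ 2) * (q ^ 2) ^ (k + 1) \<le> fact ((k + 1) ^ 2) * real ((k + 1) ^ 2 + 1) ^ (k + 1)"
      by (intro mult_left_mono power_mono) (auto simp: q_def)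
    also have "\<dots> \<le> fact ((k + 1) ^ 2 + (k + 1))" by (rule fact_mult_power_le_fact)
    also have "(k + 1) ^ 2 + (k + 1) = (k + 1) * (k + 2)" by (simp add: power2_eq_square)
    finally show ?thesis .
  qed
  then have "fact ((k + 1) ^ 2) * (q ^ 2) ^ (k + 1) / (q * fact k) ^ (k + 2)
      \<le> fact ((k + 1) * (k + 2)) / (q * fact k) ^ (k + 2)"
    using q by (intro divide_right_mono) auto
  moreover have "fact ((k + 1) ^ 2) * (q ^ 2) ^ (k + 1) / (q * fact k) ^ (k + 2)
      = fact ((k + 1) ^ 2) / ((q * fact k) * fact k ^ (k + 1)) * q ^ (k + 1)"
    using q by (simp add: power2_eq_square power_mult_distrib field_simps)
  ultimately show "cross_count n * real (n - 1) ^ (n - 1) \<le> rows_count n 1"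
    unfolding r1 c fact_k1 n1 q_def[symmetric] by (simp only:)
qed

text \<open>Prescribing a fourth line can only shrink the set of squares. Neither count depends on
  the orbit, so \<open>r = 1\<close> serves; it is off the centre for
  \<open>n \<ge> 2\<close>.\<close>

lemma four_line_count_le_three_line_count:
  assumes "n \<ge> 2"
  shows "four_line_count n \<le> three_line_count n"
proof -
  define x y where "x = (1 :: nat, False)" and "y = (n + 1 - 1, True)"
  have "line_count n {x, y} {x, y} \<le> line_count n {x, y} {x}"
    unfolding line_count_def using finite_equi_squares by (intro card_mono) auto
  then have "real (line_count n {x, y} {x, y}) \<le> real (line_count n {x, y} {x})" by simp
  moreover have "(1 :: nat) \<in> {1..n}" "1 \<noteq> n + 1 - 1" using assms by auto
  ultimately show ?thesis using line_count_orbit(1,5)[of 1 n] unfolding x_def y_def by simp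
qed

text \<open>In the exact count the three-line and four-line terms add up to at most 0.\<close>

lemma card_row_and_col_lines_le:
  assumes "n \<ge> 2"
  shows "real (card {A \<in> equi_squares n. row_lines n A \<noteq> {} \<and> col_lines n A \<noteq> {}})
    \<le> 4 * real n * cross_count n"
proof -
  have "0 \<le> three_line_count n" by (simp add: three_line_count_def int_fact_def)
  then have "2 * four_line_count n \<le> 8 * three_line_count n"
    using four_line_count_le_three_line_count[OF assms] by simp
  then have "real (n div 2) * (2 * four_line_count n) \<le> real (n div 2) * (8 * three_line_count n)"
    by (rule mult_left_mono) simp
  then show ?thesis unfolding card_row_and_col_lines[OF assms] by (simp add: algebra_simps)
qed

text \<open>Union bound and Bonferroni over row indices: one index allows two directions, and each
  of the \<open>n (n - 1)\<close> ordered pairs of distinct indices allows four.\<close>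

lemma card_row_lines_bounds:
  assumes "n \<ge> 2"
  shows "real (card {A \<in> equi_squares n. row_lines n A \<noteq> {}}) \<le> 2 * real n * rows_count n 1"
    and "2 * real n * rows_count n 1 - 4 * real n * real (n - 1) * rows_count n 2
      \<le> real (card {A \<in> equi_squares n. row_lines n A \<noteq> {}})"
proof -
  let ?T = "\<lambda>A. fst ` row_lines n A"
  have one: "real (card {A \<in> equi_squares n. l \<in> ?T A}) = 2 * rows_count n 1" if "l \<in> {1..n}" for l
    using card_row_lines_superset[OF assms, of "{l}"] that by (simp add: rows_count_def)
  have two: "real (card {A \<in> equi_squares n. l \<in> ?T A \<and> m \<in> ?T A}) = 4 * rows_count n 2"
    if "l \<in> {1..n}" "m \<in> {1..n} - {l}" for l m
    using card_row_lines_superset[OF assms, of "{l, m}"] that by (simp add: rows_count_def)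
  have nonempty: "{A \<in> equi_squares n. row_lines n A \<noteq> {}} = {A \<in> equi_squares n. ?T A \<noteq> {}}" by auto
  have "{A \<in> equi_squares n. row_lines n A \<noteq> {}} = (\<Union>l\<in>{1..n}. {A \<in> equi_squares n. l \<in> ?T A})"
    using row_lines_subset by force
  then have "card {A \<in> equi_squares n. row_lines n A \<noteq> {}} \<le> (\<Sum>l\<in>{1..n}. card {A \<in> equi_squares n. l \<in> ?T A})"
    using card_UN_le[of "{1..n}"] by simp
  then have "real (card {A \<in> equi_squares n. row_lines n A \<noteq> {}})
      \<le> (\<Sum>l\<in>{1..n}. real (card {A \<in> equi_squares n. l \<in> ?T A}))"
    by (simp only: of_nat_le_iff flip: of_nat_sum)
  also have "\<dots> = (\<Sum>l\<in>{1..n}. 2 * rows_count n 1)" using one by (rule sum.cong[OF refl])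
  finally show "real (card {A \<in> equi_squares n. row_lines n A \<noteq> {}}) \<le> 2 * real n * rows_count n 1" by simp
  have "(\<Sum>l\<in>{1..n}. real (card {A \<in> equi_squares n. l \<in> ?T A}))
      - (\<Sum>l\<in>{1..n}. \<Sum>m\<in>{1..n} - {l}. real (card {A \<in> equi_squares n. l \<in> ?T A \<and> m \<in> ?T A}))
    \<le> real (card {A \<in> equi_squares n. ?T A \<noteq> {}})"
    using finite_equi_squares by (intro card_bonferroni_lower) (auto simp: row_lines_def)
  moreover have "(\<Sum>l\<in>{1..n}. real (card {A \<in> equi_squares n. l \<in> ?T A})) = (\<Sum>l\<in>{1..n}. 2 * rows_count n 1)"
    using one by (rule sum.cong[OF refl])
  moreover have "(\<Sum>l\<in>{1..n}. \<Sum>m\<in>{1..n} - {l}. real (card {A \<in> equi_squares n. l \<in> ?T A \<and> m \<in> ?T A}))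
     = (\<Sum>l\<in>{1..n}. \<Sum>m\<in>{1..n} - {l}. 4 * rows_count n 2)"
    by (rule sum.cong[OF refl], rule sum.cong[OF refl], rule two)
  ultimately show "2 * real n * rows_count n 1 - 4 * real n * real (n - 1) * rows_count n 2
      \<le> real (card {A \<in> equi_squares n. row_lines n A \<noteq> {}})"
    unfolding nonempty using assms by (simp add: algebra_simps of_nat_diff)
qed

text \<open>For \<open>n \<ge> 4\<close> both exponents \<open>n\<close> and \<open>n - 1\<close>
  are at least 3, so the two-row and the crossing terms each save a factor
  \<open>(n - 1) ^ 3\<close>. Relative to \<open>t\<close> they are then at most
  \<open>2 / (n - 1)\<^sup>2\<close> and \<open>1 / (n - 1) ^ 3\<close>.\<close>

lemma card_consecutive_bounds:
  assumes "n \<ge> 4"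
  defines "t \<equiv> 4 * real n * rows_count n 1"
  shows "real (card (consecutive_equi_squares n)) \<le> t"
    and "t * (1 - (2 * real (n - 1) + 1) / real (n - 1) ^ 3) \<le> real (card (consecutive_equi_squares n))"
proof -
  have n: "n \<ge> 2" using assms by simp
  define q where "q = real (n - 1)"
  have q: "q \<ge> 1" using assms by (simp add: q_def)
  show "real (card (consecutive_equi_squares n)) \<le> t"
    unfolding card_consecutive_equi_squares t_def using card_row_lines_bounds(1)[OF n] by simp
  have nonneg: "0 \<le> rows_count n 2" "0 \<le> cross_count n"
    by (simp_all add: rows_count_def cross_count_def int_fact_def)
  have "rows_count n 2 * q ^ 3 \<le> rows_count n 2 * q ^ n"
    using q nonneg assms by (intro mult_left_mono power_increasing) auto
  also have "\<dots> \<le> rows_count n 1" using two_rows_and_cross_count_le(1)[OF n] by (simp add: q_def)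
  finally have r2: "rows_count n 2 \<le> rows_count n 1 / q ^ 3" using q by (simp add: field_simps)
  have "cross_count n * q ^ 3 \<le> cross_count n * q ^ (n - 1)"
    using q nonneg assms by (intro mult_left_mono power_increasing) auto
  also have "\<dots> \<le> rows_count n 1" using two_rows_and_cross_count_le(2)[OF n] by (simp add: q_def)
  finally have c: "cross_count n \<le> rows_count n 1 / q ^ 3" using q by (simp add: field_simps)
  have "t * (1 - (2 * q + 1) / q ^ 3)
      = t - 8 * real n * q * (rows_count n 1 / q ^ 3) - 4 * real n * (rows_count n 1 / q ^ 3)"
    using q by (simp add: t_def field_simps)
  also have "\<dots> \<le> t - 8 * real n * q * rows_count n 2 - 4 * real n * cross_count n"
    using r2 c q by (intro diff_mono mult_left_mono) auto
  also have "\<dots> \<le> real (card (consecutive_equi_squares n))"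
    unfolding card_consecutive_equi_squares t_def
    using card_row_lines_bounds(2)[OF n] card_row_and_col_lines_le[OF n] by (simp add: q_def)
  finally show "t * (1 - (2 * real (n - 1) + 1) / real (n - 1) ^ 3) \<le> real (card (consecutive_equi_squares n))"
    by (simp add: q_def)
qed

lemma card_consecutive_asymp_equiv:
  "(\<lambda>n. real (card (consecutive_equi_squares n))) \<sim>[at_top] (\<lambda>n. 4 * real n * rows_count n 1)"
proof (rule asymp_equivI', rule tendsto_sandwich)
  have pos: "4 * real n * rows_count n 1 > 0" if "n \<ge> 4" for n
    using that rows_count_1_pos[of n] by simp
  show "\<forall>\<^sub>F n in at_top. 1 - (2 * real (n - 1) + 1) / real (n - 1) ^ 3
      \<le> real (card (consecutive_equi_squares n)) / (4 * real n * rows_count n 1)"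
    using eventually_ge_at_top[of "4::nat"]
  proof eventually_elim
    case (elim n)
    then show ?case using card_consecutive_bounds(2)[of n] pos[of n] by (simp add: pos_le_divide_eq mult.commute)
  qed
  show "\<forall>\<^sub>F n in at_top. real (card (consecutive_equi_squares n)) / (4 * real n * rows_count n 1) \<le> 1"
    using eventually_ge_at_top[of "4::nat"]
  proof eventually_elim
    case (elim n)
    then show ?case using card_consecutive_bounds(1)[of n] pos[of n] by (simp add: pos_divide_le_eq)
  qed
  show "(\<lambda>n. 1 - (2 * real (n - 1) + 1) / real (n - 1) ^ 3) \<longlonglongrightarrow> 1"
    by real_asymp
qed simp

text \<open>The closed formula starts at \<open>n = 2\<close>: for \<open>n = 1\<close> both
  directions coincide, and the right-hand side would be \<open>4 - 4 = 0\<close> although there is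
  one such square.\<close>

theorem theorem1p1:
  shows "(\<forall>n::nat. n \<ge> 2 \<longrightarrow>
      real (card (consecutive_equi_squares n)) =
        (\<Sum>i=1..n. (-2) ^ (i + 1) * real (n choose i) *
            (int_fact (int n ^ 2 - int i * int n) / int_fact (int n - int i) ^ n))
        - 4 * real n * int_fact (int n ^ 2 - 2 * int n + 1)
            / (int_fact (int n - 1) * int_fact (int n - 2) ^ (n - 1))
        + 8 * real (n div 2) * int_fact (int n ^ 2 - 3 * int n + 2)
            / (int_fact (int n - 2) ^ 2 * int_fact (int n - 3) ^ (n - 2))
        - 2 * real (n div 2) * int_fact (int n ^ 2 - 4 * int n + 4)
            / (int_fact (int n - 2) ^ 2 * int_fact (int n - 4) ^ (n - 2)))
    \<and> (\<lambda>n::nat. real (card (consecutive_equi_squares n)))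
        \<sim>[at_top]
      (\<lambda>n. 4 * real n * int_fact (int n ^ 2 - int n) / int_fact (int n - 1) ^ n)"
proof
  show "\<forall>n::nat. n \<ge> 2 \<longrightarrow>
      real (card (consecutive_equi_squares n)) =
        (\<Sum>i=1..n. (-2) ^ (i + 1) * real (n choose i) *
            (int_fact (int n ^ 2 - int i * int n) / int_fact (int n - int i) ^ n))
        - 4 * real n * int_fact (int n ^ 2 - 2 * int n + 1)
            / (int_fact (int n - 1) * int_fact (int n - 2) ^ (n - 1))
        + 8 * real (n div 2) * int_fact (int n ^ 2 - 3 * int n + 2)
            / (int_fact (int n - 2) ^ 2 * int_fact (int n - 3) ^ (n - 2))
        - 2 * real (n div 2) * int_fact (int n ^ 2 - 4 * int n + 4)
            / (int_fact (int n - 2) ^ 2 * int_fact (int n - 4) ^ (n - 2))"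
    by (intro allI impI, subst card_consecutive_equi_squares, subst card_row_lines_nonempty, assumption,
      subst card_row_and_col_lines, assumption)
      (simp add: cross_count_def three_line_count_def four_line_count_def)
  show "(\<lambda>n::nat. real (card (consecutive_equi_squares n)))
        \<sim>[at_top]
      (\<lambda>n. 4 * real n * int_fact (int n ^ 2 - int n) / int_fact (int n - 1) ^ n)"
    using card_consecutive_asymp_equiv by (simp add: rows_count_def)
qed

end
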